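(* Let $k$, $t$, $n$ be integers with $k\geq 1$, $t\geq 1$ and $n=4k+2t$. Then \[ AR(n, kP_4\cup tP_2)=AR(n,(2k+t)P_2). \]
   Context: For a positive integer $n$ and a graph $H$, the anti-Ramsey number $AR(n,H)$ is the maximum number of colors in an edge-coloring of the complete graph $K_n$ that contains no rainbow copy of $H$ (a subgraph is rainbow if all its edges receive distinct colors). $P_l$ denotes the path on $l$ vertices, $G\cup G'$ denotes the vertex-disjoint union of graphs, and $kG$ denotes the disjoint union of $k$ copies of $G$. *)

theory Defs
  imports Main
begin

record 'a ugraph =
  verts :: "'a set"
  edges :: "'a set set"

definition simple_graph :: "'a ugraph \<Rightarrow> bool" where
  "simple_graph G \<longleftrightarrow> (\<forall>e\<in>edges G. e \<subseteq> verts G \<and> card e = 2)"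

definition subgraph :: "'a ugraph \<Rightarrow> 'a ugraph \<Rightarrow> bool" where
  "subgraph H G \<longleftrightarrow> simple_graph H \<and> verts H \<subseteq> verts G \<and> edges H \<subseteq> edges G"

definition isomorphic :: "'a ugraph \<Rightarrow> 'b ugraph \<Rightarrow> bool" where
  "isomorphic G H \<longleftrightarrow>
     (\<exists>f. bij_betw f (verts G) (verts H) \<and> edges H = (\<lambda>e. f ` e) ` edges G)"

definition complete_graph :: "nat \<Rightarrow> nat ugraph" where
  "complete_graph n = \<lparr>verts = {..<n}, edges = {e. e \<subseteq> {..<n} \<and> card e = 2}\<rparr>"

text \<open>The index \<open>l\<close> counts vertices, so \<open>path_graph 2\<close> is a single edge.\<close>

definition path_graph :: "nat \<Rightarrow> nat ugraph" where
  "path_graph l = \<lparr>verts = {..<l}, edges = {{i, Suc i} | i. Suc i < l}\<rparr>"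

definition disjoint_union :: "'a ugraph \<Rightarrow> 'b ugraph \<Rightarrow> ('a + 'b) ugraph" where
  "disjoint_union G H =
     \<lparr>verts = Inl ` verts G \<union> Inr ` verts H,
      edges = (\<lambda>e. Inl ` e) ` edges G \<union> (\<lambda>e. Inr ` e) ` edges H\<rparr>"

definition copies :: "nat \<Rightarrow> 'a ugraph \<Rightarrow> (nat \<times> 'a) ugraph" where
  "copies k G =
     \<lparr>verts = {..<k} \<times> verts G,
      edges = {Pair i ` e | i e. i < k \<and> e \<in> edges G}\<rparr>"

definition rainbow :: "('a set \<Rightarrow> 'c) \<Rightarrow> 'a ugraph \<Rightarrow> bool" where
  "rainbow c G \<longleftrightarrow> inj_on c (edges G)"

definition has_rainbow_copy :: "('a set \<Rightarrow> 'c) \<Rightarrow> 'a ugraph \<Rightarrow> 'b ugraph \<Rightarrow> bool" where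
  "has_rainbow_copy c G H \<longleftrightarrow>
     (\<exists>H'. subgraph H' G \<and> isomorphic H H' \<and> rainbow c H')"

text \<open>
  The numbers of colours actually used by edge-colourings of the complete graph without a rainbow
  copy of \<open>H\<close>. Colours are natural numbers, which is no restriction as there are finitely many
  edges; the values of \<open>c\<close> on sets that are not edges are irrelevant.
\<close>

definition rainbow_free_counts :: "nat \<Rightarrow> 'b ugraph \<Rightarrow> nat set" where
  "rainbow_free_counts n H =
     {card (c ` edges (complete_graph n)) | c :: nat set \<Rightarrow> nat.
        \<not> has_rainbow_copy c (complete_graph n) H}"

definition AR :: "nat \<Rightarrow> 'b ugraph \<Rightarrow> nat" where
  "AR n H = Max (rainbow_free_counts n H)"

text \<open>
  The maximum is over a finite set, which is nonempty as soon as \<open>H\<close> has two distinct edges.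
\<close>

lemma finite_rainbow_free_counts: "finite (rainbow_free_counts n H)"
proof (rule finite_subset)
  have "finite (edges (complete_graph n))"
    by (rule finite_subset[of _ "Pow {..<n}"]) (auto simp: complete_graph_def)
  then show "rainbow_free_counts n H \<subseteq> {..card (edges (complete_graph n))}"
    by (auto simp: rainbow_free_counts_def card_image_le)
qed simp

lemma rainbow_free_counts_nonempty:
  assumes H: "simple_graph H" and e: "e \<in> edges H" "e' \<in> edges H" "e \<noteq> e'"
  shows "rainbow_free_counts n H \<noteq> {}"
proof -
  have "\<not> has_rainbow_copy (\<lambda>_. 0 :: nat) (complete_graph n) H"
  proof
    assume "has_rainbow_copy (\<lambda>_. 0 :: nat) (complete_graph n) H"
    then obtain H' :: "nat ugraph" and f where f: "bij_betw f (verts H) (verts H')"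
      and E: "edges H' = (\<lambda>e. f ` e) ` edges H" and R: "inj_on (\<lambda>_. 0 :: nat) (edges H')"
      unfolding has_rainbow_copy_def isomorphic_def rainbow_def by blast
    have "f ` e \<in> edges H'" "f ` e' \<in> edges H'"
      unfolding E using e(1,2) by (simp_all only: imageI)
    then have "f ` e = f ` e'"
      by (rule inj_onD[OF R refl])
    moreover have "e \<subseteq> verts H" "e' \<subseteq> verts H"
      using H e(1,2) unfolding simple_graph_def by simp_all
    ultimately show False
      using inj_on_image_eq_iff[OF bij_betw_imp_inj_on[OF f]] e(3) by simp
  qed
  then show ?thesis
    by (auto simp: rainbow_free_counts_def)
qed

lemma simple_graph_complete_graph: "simple_graph (complete_graph n)"
  by (simp add: simple_graph_def complete_graph_def)

lemma simple_graph_path_graph: "simple_graph (path_graph l)"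
  by (auto simp: simple_graph_def path_graph_def)

lemma simple_graph_disjoint_union:
  "simple_graph G \<Longrightarrow> simple_graph H \<Longrightarrow> simple_graph (disjoint_union G H)"
  by (fastforce simp: simple_graph_def disjoint_union_def card_image)

lemma simple_graph_copies: "simple_graph G \<Longrightarrow> simple_graph (copies k G)"
  by (auto simp: simple_graph_def copies_def card_image inj_on_def)

end

theory Submission
  imports Defs Complex_Main
begin

text \<open>
  Put \<open>m = 2k + t\<close>, so that \<open>n = 2m\<close>. As \<open>mP\<^sub>2\<close> is a spanning subgraph of \<open>kP\<^sub>4 \<union> tP\<^sub>2\<close>, only
  the upper bound on the left-hand side needs work, and only for colourings with a rainbow perfect
  matching. Choose one representative edge for each of the remaining \<open>N - m\<close> colours and contract the
  edges of the matching. The representatives give a graph \<open>\<Gamma>\<close> on \<open>m\<close> vertices with at least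
  \<open>(N - m) / 4\<close> edges, and any \<open>k\<close> disjoint edges of \<open>\<Gamma>\<close> extend the matching to a rainbow
  \<open>kP\<^sub>4 \<union> tP\<^sub>2\<close>. They exist as soon as \<open>N\<close> exceeds \<open>(n-3 choose 2) + 2\<close>, and that many colours
  are always possible without a rainbow perfect matching.
\<close>

section \<open>Rainbow copies in complete graphs as injective maps\<close>

text \<open>In a complete host every injective image of a simple graph is a subgraph, so a copy
  amounts to an injective vertex map. Colours can be compared on the edges of \<open>H\<close>
  itself, because \<open>f\<close> sends distinct edges to distinct edges.\<close>

lemma has_rainbow_copy_complete_iff:
  assumes H: "simple_graph H"
  shows "has_rainbow_copy c (complete_graph n) H \<longleftrightarrow>
    (\<exists>f. inj_on f (verts H) \<and> f ` verts H \<subseteq> {..<n} \<and> inj_on (\<lambda>e. c (f ` e)) (edges H))"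
    (is "_ \<longleftrightarrow> ?rhs")
proof
  assume "has_rainbow_copy c (complete_graph n) H"
  then obtain H' f where H': "subgraph H' (complete_graph n)" "bij_betw f (verts H) (verts H')"
    "edges H' = (\<lambda>e. f ` e) ` edges H" "inj_on c (edges H')"
    unfolding has_rainbow_copy_def isomorphic_def rainbow_def by blast
  have "inj_on f (verts H)"
    using H'(2) by (rule bij_betw_imp_inj_on)
  moreover have "f ` verts H \<subseteq> {..<n}"
    using H'(1,2) by (auto simp: bij_betw_def subgraph_def complete_graph_def)
  moreover have "inj_on (\<lambda>e. f ` e) (edges H)"
    by (rule inj_on_subset[OF inj_on_image_Pow[OF \<open>inj_on f (verts H)\<close>]])
       (use H in \<open>auto simp: simple_graph_def\<close>)
  then have "inj_on (c \<circ> (\<lambda>e. f ` e)) (edges H)"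
    using H'(3,4) by (intro comp_inj_on) simp_all
  ultimately show ?rhs
    unfolding comp_def by blast
next
  assume ?rhs
  then obtain f where f: "inj_on f (verts H)" "f ` verts H \<subseteq> {..<n}"
    "inj_on (\<lambda>e. c (f ` e)) (edges H)" by blast
  define H' where "H' = \<lparr>verts = f ` verts H, edges = (\<lambda>e. f ` e) ` edges H\<rparr>"
  have e: "f ` e \<subseteq> f ` verts H" "card (f ` e) = 2" if "e \<in> edges H" for e
  proof -
    have "e \<subseteq> verts H" "card e = 2"
      using H that by (auto simp: simple_graph_def)
    then show "f ` e \<subseteq> f ` verts H" "card (f ` e) = 2"
      using card_image[OF inj_on_subset[OF f(1)], of e] by auto
  qed
  then have "subgraph H' (complete_graph n)"
    using f(2) by (fastforce simp: subgraph_def complete_graph_def simple_graph_def H'_def)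
  moreover have "isomorphic H H'"
    using f(1) by (auto simp: isomorphic_def H'_def bij_betw_def)
  moreover have "rainbow c H'"
    using f(3) by (auto simp: rainbow_def H'_def inj_on_def)
  ultimately show "has_rainbow_copy c (complete_graph n) H"
    unfolding has_rainbow_copy_def by blast
qed

text \<open>The vertex maps compose: distinct edges of \<open>H'\<close> go to distinct edges of
  \<open>H\<close>, and these have distinct colours.\<close>

lemma has_rainbow_copy_complete_mono:
  assumes H: "simple_graph H" "simple_graph H'"
    and g: "inj_on g (verts H')" "g ` verts H' \<subseteq> verts H" "\<And>e. e \<in> edges H' \<Longrightarrow> g ` e \<in> edges H"
    and copy: "has_rainbow_copy c (complete_graph n) H"
  shows "has_rainbow_copy c (complete_graph n) H'"
proof -
  obtain f where f: "inj_on f (verts H)" "f ` verts H \<subseteq> {..<n}"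
    "inj_on (\<lambda>e. c (f ` e)) (edges H)"
    using copy has_rainbow_copy_complete_iff[OF H(1)] by blast
  have "inj_on (f \<circ> g) (verts H')"
    using f(1) g(1,2) by (intro comp_inj_on) (auto intro: inj_on_subset)
  moreover have "(f \<circ> g) ` verts H' \<subseteq> {..<n}"
    using f(2) g(2) by auto
  moreover have "inj_on (\<lambda>e. g ` e) (edges H')"
    by (rule inj_on_subset[OF inj_on_image_Pow[OF g(1)]])
       (use H in \<open>auto simp: simple_graph_def\<close>)
  then have "inj_on ((\<lambda>e. c (f ` e)) \<circ> (\<lambda>e. g ` e)) (edges H')"
    using f(3) g(3) by (intro comp_inj_on) (auto intro: inj_on_subset)
  then have "inj_on (\<lambda>e. c ((f \<circ> g) ` e)) (edges H')"
    by (simp add: comp_def image_image)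
  ultimately show ?thesis
    using has_rainbow_copy_complete_iff[OF H(2)] by blast
qed

section \<open>The perfect matching inside the linear forest\<close>

lemma verts_copies_path: "verts (copies k (path_graph l)) = {..<k} \<times> {..<l}"
  by (simp add: copies_def path_graph_def)

lemma edges_copies_path:
  "edges (copies k (path_graph l)) = {{(i, j), (i, Suc j)} | i j. i < k \<and> Suc j < l}"
  by (auto simp: copies_def path_graph_def) blast+

lemma edges_copies_path_2: "edges (copies k (path_graph 2)) = (\<lambda>i. {(i, 0), (i, 1)}) ` {..<k}"
  unfolding edges_copies_path by auto

lemma edges_copies_path_4:
  "edges (copies k (path_graph 4)) = (\<lambda>i. {(i, 0), (i, 1)}) ` {..<k}
    \<union> (\<lambda>i. {(i, 1), (i, 2)}) ` {..<k} \<union> (\<lambda>i. {(i, 2), (i, 3)}) ` {..<k}"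
proof -
  have "Suc j < 4 \<longleftrightarrow> j = 0 \<or> j = 1 \<or> j = 2" for j :: nat by auto
  then show ?thesis
    unfolding edges_copies_path by (auto simp: eval_nat_numeral)
qed

text \<open>The two end edges of each path on four vertices are disjoint, so together with the
  \<open>t\<close> single edges they form \<open>2 * k + t\<close> disjoint edges.\<close>

lemma rainbow_matching_of_rainbow_linear_forest:
  assumes "has_rainbow_copy c (complete_graph n)
    (disjoint_union (copies k (path_graph 4)) (copies t (path_graph 2)))"
  shows "has_rainbow_copy c (complete_graph n) (copies (2 * k + t) (path_graph 2))"
proof (rule has_rainbow_copy_complete_mono[OF _ _ _ _ _ assms])
  \<comment> \<open>Matching edges \<open>2 * i\<close> and \<open>2 * i + 1\<close> become the end
    edges of path \<open>i\<close>; the last \<open>t\<close> become the single edges.\<close>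
  define g :: "nat \<times> nat \<Rightarrow> nat \<times> nat + nat \<times> nat" where
    "g = (\<lambda>(i, j). if i < 2 * k then Inl (i div 2, 2 * (i mod 2) + j) else Inr (i - 2 * k, j))"
  show "inj_on g (verts (copies (2 * k + t) (path_graph 2)))"
  proof (rule inj_on_inverseI)
    fix x assume "x \<in> verts (copies (2 * k + t) (path_graph 2))"
    then obtain i j where x: "x = (i, j)" "j < 2" by (auto simp: verts_copies_path)
    then have "j div 2 = 0" by simp
    then have "(2 * (i mod 2) + j) div 2 = i mod 2" "(2 * (i mod 2) + j) mod 2 = j"
      using x(2) by simp_all
    then show "case_sum (\<lambda>(i, j). (2 * i + j div 2, j mod 2)) (\<lambda>(i, j). (2 * k + i, j)) (g x) = x"
      using x by (simp add: g_def)
  qed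
  show "g ` verts (copies (2 * k + t) (path_graph 2)) \<subseteq>
      verts (disjoint_union (copies k (path_graph 4)) (copies t (path_graph 2)))"
    unfolding disjoint_union_def verts_copies_path g_def by (auto split: if_splits)
  show "g ` e \<in> edges (disjoint_union (copies k (path_graph 4)) (copies t (path_graph 2)))"
    if "e \<in> edges (copies (2 * k + t) (path_graph 2))" for e
  proof -
    obtain i where i: "i < 2 * k + t" "e = {(i, 0), (i, 1)}"
      using \<open>e \<in> edges (copies (2 * k + t) (path_graph 2))\<close> by (auto simp: edges_copies_path_2)
    show ?thesis
    proof (cases "i < 2 * k")
      case True
      have "{(i div 2, 2 * (i mod 2)), (i div 2, Suc (2 * (i mod 2)))} \<in> edges (copies k (path_graph 4))"
        unfolding edges_copies_path
        by (rule CollectI, rule exI[of _ "i div 2"], rule exI[of _ "2 * (i mod 2)"]) (use True in auto)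
      moreover have "g ` e = Inl ` {(i div 2, 2 * (i mod 2)), (i div 2, Suc (2 * (i mod 2)))}"
        using True i by (simp add: g_def)
      ultimately have "g ` e \<in> (\<lambda>e. Inl ` e) ` edges (copies k (path_graph 4))"
        by (simp only: imageI)
      then show ?thesis
        by (simp add: disjoint_union_def)
    next
      case False
      have "{(i - 2 * k, 0), (i - 2 * k, 1)} \<in> edges (copies t (path_graph 2))"
        using False i unfolding edges_copies_path_2 by auto
      moreover have "g ` e = Inr ` {(i - 2 * k, 0), (i - 2 * k, 1)}"
        using False i by (simp add: g_def)
      ultimately have "g ` e \<in> (\<lambda>e. Inr ` e) ` edges (copies t (path_graph 2))"
        by (simp only: imageI)
      then show ?thesis
        by (simp add: disjoint_union_def)
    qed
  qed
qed (intro simple_graph_disjoint_union simple_graph_copies simple_graph_path_graph)+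

section \<open>Large matchings in dense graphs\<close>

text \<open>
  For a maximum matching \<open>M\<close> that leaves a set \<open>U\<close> of at least three vertices uncovered, \<open>U\<close> is
  independent, and every edge of \<open>M\<close> is joined to \<open>U\<close> by at most \<open>card U\<close> edges, because otherwise
  there is an augmenting path of length three. Hence \<open>2 * card E \<le> (card V - 1) * (card V - 3)\<close>.
\<close>

lemma exists_large_matching:
  assumes V: "finite V" and E: "\<And>e. e \<in> E \<Longrightarrow> e \<subseteq> V \<and> card e = 2"
    and many: "card V * card V + 3 < 2 * card E + 4 * card V"
  obtains M where "M \<subseteq> E" "pairwise disjnt M" "card V \<le> 2 * card M + 2"
proof -
  have "finite E"
    using E V by (intro finite_subset[of E "Pow V"]) auto
  define P where "P = (\<lambda>M. M \<subseteq> E \<and> pairwise disjnt M)"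
  have "\<exists>M. P M \<and> (\<forall>M'. P M' \<longrightarrow> card M' \<le> card M)"
    by (rule ex_has_greatest_nat[of P "{}" card "Suc (card E)"])
       (use \<open>finite E\<close> in \<open>auto simp: P_def card_mono less_Suc_eq_le\<close>)
  then obtain M where M: "M \<subseteq> E" "pairwise disjnt M" and max: "\<And>M'. P M' \<Longrightarrow> card M' \<le> card M"
    unfolding P_def by auto
  have "finite M"
    using M(1) \<open>finite E\<close> finite_subset by blast
  define W U s where "W = \<Union>M" and "U = V - W" and "s = card M"
  have "W \<subseteq> V" using M(1) E by (auto simp: W_def)
  have "finite W" "finite U" using V \<open>W \<subseteq> V\<close> finite_subset by (auto simp: U_def)
  have cardW: "card W = 2 * s"
  proof -
    have "card W = (\<Sum>e\<in>M. card e)" unfolding W_def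
      by (rule card_Union_disjoint[OF M(2)]) (use M(1) E V finite_subset in blast)
    also have "\<dots> = 2 * s" using M(1) E by (subst sum.cong[of M M card "\<lambda>_. 2"]) (auto simp: s_def)
    finally show ?thesis .
  qed
  have cardU: "card V = 2 * s + card U"
    using card_Diff_subset[OF \<open>finite W\<close> \<open>W \<subseteq> V\<close>] card_mono[OF V \<open>W \<subseteq> V\<close>] cardW by (simp add: U_def)
  have "card V \<le> 2 * s + 2"
  proof (rule ccontr)
    assume "\<not> card V \<le> 2 * s + 2"
    then have u: "card U \<ge> 3" using cardU by simp
    \<comment> \<open>An edge missing \<open>W\<close> could be added to \<open>M\<close>.\<close>
    have indep: "e \<inter> W \<noteq> {}" if "e \<in> E" for e
    proof
      assume "e \<inter> W = {}"
      moreover have "e \<noteq> {}" using E[OF that] by auto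
      ultimately have "e \<notin> M" by (auto simp: W_def)
      moreover have "P (insert e M)" using M that \<open>e \<inter> W = {}\<close>
        by (auto simp: P_def W_def pairwise_insert disjnt_def)
      ultimately show False using max[of "insert e M"] \<open>finite M\<close> by simp
    qed
    define X where "X = (\<lambda>d. {e \<in> E. e \<inter> d \<noteq> {} \<and> e \<inter> U \<noteq> {}})"
    have X: "card (X d) \<le> card U" if "d \<in> M" for d
    proof -
      have "card d = 2" using that M E by auto
      then obtain x y where d: "d = {x, y}" "x \<noteq> y" by (meson card_2_iff)
      have xy: "x \<notin> U" "y \<notin> U" using that d by (auto simp: U_def W_def)
      define N where "N = (\<lambda>z. {w \<in> U. {z, w} \<in> E})"
      have fin: "finite (N z)" for z using \<open>finite U\<close> by (simp add: N_def)
      have "X d \<subseteq> (\<lambda>w. {x, w}) ` N x \<union> (\<lambda>w. {y, w}) ` N y"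
      proof
        fix e assume "e \<in> X d"
        then obtain z w where zw: "e \<in> E" "z \<in> e" "z \<in> d" "w \<in> e" "w \<in> U" by (auto simp: X_def)
        have "z \<noteq> w" using zw xy d by auto
        then have "e = {z, w}" using E[OF zw(1)] zw by (auto simp: card_2_iff)
        then show "e \<in> (\<lambda>w. {x, w}) ` N x \<union> (\<lambda>w. {y, w}) ` N y"
          using zw d by (auto simp: N_def)
      qed
      then have "card (X d) \<le> card ((\<lambda>w. {x, w}) ` N x \<union> (\<lambda>w. {y, w}) ` N y)"
        by (intro card_mono) (use fin in auto)
      also have "\<dots> \<le> card ((\<lambda>w. {x, w}) ` N x) + card ((\<lambda>w. {y, w}) ` N y)"
        by (rule card_Un_le)
      also have "\<dots> \<le> card (N x) + card (N y)"
        by (intro add_mono card_image_le fin)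
      also have "\<dots> \<le> card U"
      proof -
        \<comment> \<open>Augmentation: if \<open>w\<close> and \<open>w'\<close> differ, exchanging
          \<open>d\<close> for the edges \<open>{x, w}\<close> and \<open>{y, w'}\<close> yields a
          larger matching.\<close>
        have same: "w = w'" if w: "w \<in> N x" "w' \<in> N y" for w w'
        proof (rule ccontr)
          assume "w \<noteq> w'"
          define M' where "M' = insert {x, w} (insert {y, w'} (M - {d}))"
          have wU: "w \<in> U" "w' \<in> U" "{x, w} \<in> E" "{y, w'} \<in> E" using w by (auto simp: N_def)
          have out: "{x, w} \<inter> e = {} \<and> {y, w'} \<inter> e = {}" if "e \<in> M - {d}" for e
          proof -
            have "e \<inter> d = {}" using that \<open>d \<in> M\<close> M(2) by (auto simp: pairwise_def disjnt_def)
            then show ?thesis using that wU d by (auto simp: U_def W_def)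
          qed
          have ne: "{x, w} \<inter> {y, w'} = {}" using \<open>w \<noteq> w'\<close> d xy wU by auto
          have "pairwise disjnt (M - {d})" using M(2) by (rule pairwise_subset) auto
          then have "P M'"
            using M(1) wU out ne by (auto simp: P_def M'_def pairwise_insert disjnt_def)
          moreover have "card M' = card M + 1"
          proof -
            have "{y, w'} \<notin> M - {d}" "{x, w} \<notin> insert {y, w'} (M - {d})"
              using out ne by blast+
            then show ?thesis
              using \<open>finite M\<close> \<open>d \<in> M\<close> card_Suc_Diff1[of M d] by (simp add: M'_def)
          qed
          ultimately show False using max[of M'] by simp
        qed
        have le: "card (N z) \<le> card U" for z
          using \<open>finite U\<close> by (intro card_mono) (auto simp: N_def)
        \<comment> \<open>If both neighbourhoods are nonempty, they are the same singleton and
          contribute two edges in all; here \<open>card U \<ge> 3\<close> enters.\<close>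
        show ?thesis
        proof (cases "N x = {} \<or> N y = {}")
          case True
          then show ?thesis using le by auto
        next
          case False
          then obtain w where "N x = {w}" "N y = {w}" using same by blast
          then show ?thesis using u by simp
        qed
      qed
      finally show ?thesis .
    qed
    have "E \<subseteq> {e. e \<subseteq> W \<and> card e = 2} \<union> (\<Union>d\<in>M. X d)"
    proof
      fix e assume "e \<in> E"
      then have "e \<subseteq> W \<or> e \<inter> U \<noteq> {}" using E by (auto simp: U_def)
      then show "e \<in> {e. e \<subseteq> W \<and> card e = 2} \<union> (\<Union>d\<in>M. X d)"
        using E \<open>e \<in> E\<close> indep[OF \<open>e \<in> E\<close>] by (auto simp: X_def W_def)
    qed
    then have "card E \<le> card ({e. e \<subseteq> W \<and> card e = 2} \<union> (\<Union>d\<in>M. X d))"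
      by (rule card_mono[rotated])
         (use \<open>finite W\<close> \<open>finite M\<close> \<open>finite E\<close> in \<open>auto simp: X_def\<close>)
    also have "\<dots> \<le> card {e. e \<subseteq> W \<and> card e = 2} + card (\<Union>d\<in>M. X d)"
      by (rule card_Un_le)
    also have "card {e. e \<subseteq> W \<and> card e = 2} = (2 * s) choose 2"
      using n_subsets[OF \<open>finite W\<close>] cardW by simp
    also have "card (\<Union>d\<in>M. X d) \<le> (\<Sum>d\<in>M. card (X d))"
      by (rule card_UN_le[OF \<open>finite M\<close>])
    also have "\<dots> \<le> s * card U"
      using sum_bounded_above[of M "\<lambda>d. card (X d)" "card U"] X by (simp add: s_def)
    finally have le: "card E \<le> ((2 * s) choose 2) + s * card U" by simp
    obtain v where v: "card U = v + 3" using u by (metis add.commute le_Suc_ex)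
    \<comment> \<open>By \<open>many\<close>, \<open>2 * card E\<close> exceeds
      \<open>(card V - 1) * (card V - 3)\<close>. With \<open>card V = 2 * s + v + 3\<close> this
      product is larger than the upper estimate for \<open>2 * card E\<close> by
      \<open>2 * s * v + v * (v + 2)\<close>, which is never negative.\<close>
    have "2 * ((2 * s) choose 2) + 2 * s = 4 * s * s"
      by (cases s) (auto simp: choose_two algebra_simps)
    with le have "2 * card E + 2 * s \<le> 4 * s * s + 2 * s * (v + 3)"
      unfolding v by (simp add: algebra_simps)
    with many show False
      unfolding cardU v by (simp add: algebra_simps)
  qed
  with M that show ?thesis by (simp add: s_def)
qed

section \<open>Many colours without a rainbow perfect matching\<close>

text \<open>
  A perfect matching contains either one of the three pairs inside \<open>{0, 1, 2}\<close> together with an edge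
  at the third vertex, which then have the same colour, or three edges with colours in \<open>{0, 1}\<close>.
\<close>

lemma exists_colouring_without_rainbow_perfect_matching:
  assumes m: "m \<ge> 3"
  obtains c :: "nat set \<Rightarrow> nat"
  where "\<not> has_rainbow_copy c (complete_graph (2 * m)) (copies m (path_graph 2))"
    and "2 * m * m + 8 \<le> card (c ` edges (complete_graph (2 * m))) + 7 * m"
proof -
  define R :: "nat set set" where "R = {e. e \<subseteq> {3..<2 * m} \<and> card e = 2}"
  have "finite R" by (rule finite_subset[of _ "Pow {3..<2 * m}"]) (auto simp: R_def)
  then obtain h :: "nat set \<Rightarrow> nat" where h: "inj_on h R"
    using finite_imp_inj_to_nat_seg by blast
  \<comment> \<open>Pairs in \<open>R\<close> get private colours from 2 on. Each pair inside
    \<open>{0, 1, 2}\<close> shares its colour with the edges joining the third vertex to the rest: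
    colour 0 for the pair \<open>{0, 1}\<close>, colour 1 for the other two pairs.\<close>
  define c :: "nat set \<Rightarrow> nat" where "c = (\<lambda>e. if e \<in> R then h e + 2
      else if e = {0, 1} \<or> 2 \<in> e \<and> 0 \<notin> e \<and> 1 \<notin> e then 0 else 1)"
  have "\<not> has_rainbow_copy c (complete_graph (2 * m)) (copies m (path_graph 2))"
  proof
    assume "has_rainbow_copy c (complete_graph (2 * m)) (copies m (path_graph 2))"
    then obtain f where f: "inj_on f ({..<m} \<times> {..<2})" "f ` ({..<m} \<times> {..<2}) \<subseteq> {..<2 * m}"
      "inj_on (\<lambda>e. c (f ` e)) (edges (copies m (path_graph 2)))"
      unfolding has_rainbow_copy_complete_iff[OF simple_graph_copies[OF simple_graph_path_graph]]
        verts_copies_path by blast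
    define e where "e = (\<lambda>i. {f (i, 0), f (i, 1)})"
    \<comment> \<open>\<open>f\<close> maps a set of size \<open>2 * m\<close> injectively into one
      of the same size, so the matching is perfect.\<close>
    have surj: "f ` ({..<m} \<times> {..<2}) = {..<2 * m}"
      by (rule card_subset_eq[OF _ f(2)]) (simp_all add: card_image[OF f(1)])
    have *: "\<exists>i<m. v \<in> e i" if "v < 2 * m" for v
    proof -
      have "v \<in> f ` ({..<m} \<times> {..<2})" using surj that by simp
      then obtain i j where "i < m" "j < 2" "v = f (i, j)" by auto
      moreover have "j = 0 \<or> j = 1" using \<open>j < 2\<close> by auto
      ultimately show ?thesis by (auto simp: e_def)
    qed
    obtain i0 i1 i2 where i: "i0 < m" "i1 < m" "i2 < m" "0 \<in> e i0" "1 \<in> e i1" "2 \<in> e i2"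
    proof -
      have "0 < 2 * m" "1 < 2 * m" "2 < 2 * m" using m by simp_all
      with * show thesis using that by metis
    qed
    have disj: "e i \<inter> e j = {}" if "i < m" "j < m" "i \<noteq> j" for i j
    proof -
      have "f (i, x) \<noteq> f (j, y)" if "x < 2" "y < 2" for x y
        using inj_onD[OF f(1), of "(i, x)" "(j, y)"] that \<open>i < m\<close> \<open>j < m\<close> \<open>i \<noteq> j\<close> by auto
      then have "f (i, x) \<noteq> f (j, y)" if "x \<in> {0, 1}" "y \<in> {0, 1}" for x y
        using that by auto
      then show ?thesis by (force simp: e_def)
    qed
    have cinj: "c (e i) \<noteq> c (e j)" if "i < m" "j < m" "i \<noteq> j" for i j
    proof
      assume eq: "c (e i) = c (e j)"
      have "{(i, 0), (i, 1)} = {(j, 0), (j, 1 :: nat)}"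
        by (rule inj_onD[OF f(3)]) (use that eq in \<open>auto simp: edges_copies_path_2 e_def\<close>)
      then show False using that by (auto simp: doubleton_eq_iff)
    qed
    have two: "e i = {x, y}" if "x \<in> e i" "y \<in> e i" "x \<noteq> y" for i x y
      using that by (auto simp: e_def)
    have zero: "c d = 0" if "d = {0, 1} \<or> 2 \<in> d \<and> 0 \<notin> d \<and> 1 \<notin> d" for d
      using that by (auto simp: c_def R_def)
    have one: "c d = 1" if "v \<in> d" "v < 2" "v' \<notin> d" "v' < 2" for d v v'
    proof -
      have "d \<notin> R" using that by (auto simp: R_def)
      moreover have "d \<noteq> {0, 1}" "0 \<in> d \<or> 1 \<in> d" using that by (auto simp: less_2_cases_iff)
      ultimately show ?thesis by (simp add: c_def)
    qed
    \<comment> \<open>Edges meeting \<open>{0, 1, 2}\<close> have only two colours, which rules out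
      three separate matching edges at these vertices.\<close>
    have c2: "c d < 2" if "v \<in> d" "v < 3" for d v
      using that by (auto simp: c_def R_def)
    consider "i0 = i1" | "i0 = i2" | "i1 = i2" | "i0 \<noteq> i1" "i0 \<noteq> i2" "i1 \<noteq> i2" by blast
    then show False
    proof cases
      case 1
      have e: "e i0 = {0, 1}" by (rule two) (use 1 i in simp_all)
      then have "2 \<notin> e i0" by simp
      then have ne: "i0 \<noteq> i2" using i(6) by blast
      have "0 \<notin> e i2" "1 \<notin> e i2" using disj[OF i(1) i(3) ne] e by blast+
      then have "c (e i0) = c (e i2)" using zero[of "e i0"] zero[of "e i2"] e i(6) by simp
      then show False using cinj[OF i(1) i(3) ne] by simp
    next
      case 2
      have e: "e i0 = {0, 2}" by (rule two) (use 2 i in simp_all)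
      then have "1 \<notin> e i0" by simp
      then have ne: "i0 \<noteq> i1" using i(5) by blast
      have "0 \<notin> e i1" using disj[OF i(1) i(2) ne] e by blast
      then have "c (e i0) = c (e i1)"
        using one[of 0 "e i0" 1] one[of 1 "e i1" 0] i(4,5) \<open>1 \<notin> e i0\<close> by simp
      then show False using cinj[OF i(1) i(2) ne] by simp
    next
      case 3
      have e: "e i1 = {1, 2}" by (rule two) (use 3 i in simp_all)
      then have "0 \<notin> e i1" by simp
      then have ne: "i0 \<noteq> i1" using i(4) by blast
      have "1 \<notin> e i0" using disj[OF i(1) i(2) ne] e by blast
      then have "c (e i0) = c (e i1)"
        using one[of 0 "e i0" 1] one[of 1 "e i1" 0] i(4,5) \<open>0 \<notin> e i1\<close> by simp
      then show False using cinj[OF i(1) i(2) ne] by simp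
    next
      case 4
      then have "c (e i0) \<noteq> c (e i1)" "c (e i0) \<noteq> c (e i2)" "c (e i1) \<noteq> c (e i2)"
        using cinj i by blast+
      then show False using c2[OF i(4)] c2[OF i(5)] c2[OF i(6)] by simp
    qed
  qed
  moreover have "2 * m * m + 8 \<le> card (c ` edges (complete_graph (2 * m))) + 7 * m"
  proof -
    \<comment> \<open>The colours of \<open>R\<close> together with 0 and 1 give at least
      \<open>card R + 2\<close> colours; the target is \<open>((2 * m - 3) choose 2) + 2\<close>,
      rearranged to avoid subtraction.\<close>
    have sub: "insert {0, 1} (insert {0, 2} R) \<subseteq> edges (complete_graph (2 * m))"
      using m by (auto simp: complete_graph_def R_def)
    have fin: "finite (edges (complete_graph (2 * m)))"
      by (rule finite_subset[of _ "Pow {..<2 * m}"]) (auto simp: complete_graph_def)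
    have nR: "{0, 1} \<notin> R" "{0, 2} \<notin> R" by (auto simp: R_def)
    have "c {0, 1} = 0" "c {0, 2} = 1"
      using nR by (auto simp: c_def doubleton_eq_iff)
    moreover have cR: "c e = h e + 2" if "e \<in> R" for e using that by (simp add: c_def)
    then have "0 \<notin> c ` R" "1 \<notin> c ` R" "inj_on c R" using h by (auto simp: inj_on_def)
    ultimately have "card (c ` insert {0, 1} (insert {0, 2} R)) = card R + 2"
      using \<open>finite R\<close> by (auto simp: card_insert_if card_image)
    then have "card R + 2 \<le> card (c ` edges (complete_graph (2 * m)))"
      using card_mono[OF finite_imageI[OF fin] image_mono[OF sub]] by metis
    moreover have "card R = (2 * m - 3) choose 2"
      using n_subsets[of "{3..<2 * m}" 2] by (simp add: R_def)
    moreover obtain l where l: "m = l + 3" using m by (metis add.commute le_Suc_ex)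
    have "(2 * m - 3) choose 2 = (2 * l + 3) * (l + 1)"
      unfolding l choose_two by (simp add: algebra_simps)
    ultimately show ?thesis unfolding l by (simp add: algebra_simps)
  qed
  ultimately show thesis by (rule that)
qed

section \<open>Extending a rainbow perfect matching to the linear forest\<close>

text \<open>For \<open>m \<ge> 2\<close> the threshold in \<open>many\<close> is
  \<open>((2 * m - 3) choose 2) + 2\<close>. It forces enough edges into the contracted graph to
  find \<open>k\<close> disjoint ones, and each of these links two matching edges into a path on
  four vertices.\<close>

lemma rainbow_linear_forest_of_rainbow_perfect_matching:
  fixes c :: "nat set \<Rightarrow> nat"
  assumes t: "t \<ge> 1" and m: "m = 2 * k + t"
    and copy: "has_rainbow_copy c (complete_graph (2 * m)) (copies m (path_graph 2))"
    and many: "2 * m * m + 8 < card (c ` edges (complete_graph (2 * m))) + 7 * m"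
  shows "has_rainbow_copy c (complete_graph (2 * m))
    (disjoint_union (copies k (path_graph 4)) (copies t (path_graph 2)))"
proof -
  obtain f where f: "inj_on f ({..<m} \<times> {..<2})" "f ` ({..<m} \<times> {..<2}) \<subseteq> {..<2 * m}"
    "inj_on (\<lambda>e. c (f ` e)) (edges (copies m (path_graph 2)))"
    using copy
    unfolding has_rainbow_copy_complete_iff[OF simple_graph_copies[OF simple_graph_path_graph]]
      verts_copies_path by blast
  have surj: "f ` ({..<m} \<times> {..<2}) = {..<2 * m}"
    by (rule card_subset_eq[OF _ f(2)]) (simp_all add: card_image[OF f(1)])
  define K where "K = edges (complete_graph (2 * m))"
  have K: "K = {e. e \<subseteq> {..<2 * m} \<and> card e = 2}" by (simp add: K_def complete_graph_def)
  have finK: "finite K" by (rule finite_subset[of _ "Pow {..<2 * m}"]) (auto simp: K)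
  define e where "e = (\<lambda>i. {f (i, 0), f (i, 1)})"
  \<comment> \<open>\<open>g\<close> recovers the label of a vertex, \<open>p\<close> the index of
    its matching edge and \<open>opp\<close> the other end of that edge.\<close>
  define g where "g = inv_into ({..<m} \<times> {..<2}) f"
  define p where "p = (\<lambda>v. fst (g v))"
  define opp where "opp = (\<lambda>v. f (p v, 1 - snd (g v)))"
  have gf: "g (f (i, j)) = (i, j)" if "i < m" "j < 2" for i j
    unfolding g_def by (rule inv_into_f_f[OF f(1)]) (use that in auto)
  have vert: "\<exists>i j. i < m \<and> j < 2 \<and> v = f (i, j)" if "v < 2 * m" for v
  proof -
    have "v \<in> f ` ({..<m} \<times> {..<2})" using surj that by simp
    then show ?thesis by auto
  qed
  have p_less: "p v < m" and opp: "{opp v, v} = e (p v)" "{v, opp v} = e (p v)" if "v < 2 * m" for v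
  proof -
    obtain i j where ij: "i < m" "j < 2" "v = f (i, j)" using vert[OF \<open>v < 2 * m\<close>] by blast
    then have "j = 0 \<or> j = 1" by auto
    with ij show "p v < m" "{opp v, v} = e (p v)" "{v, opp v} = e (p v)"
      by (auto simp: p_def opp_def gf e_def)
  qed
  have eK: "e i \<in> K" if "i < m" for i
  proof -
    have "f (i, 0) \<in> {..<2 * m}" "f (i, 1) \<in> {..<2 * m}"
      by (rule subsetD[OF f(2)], use that in simp)+
    moreover have "f (i, 0) \<noteq> f (i, 1)" using inj_onD[OF f(1), of "(i, 0)" "(i, 1)"] that by auto
    ultimately show ?thesis by (simp add: K e_def)
  qed
  define C0 where "C0 = (\<lambda>i. c (e i)) ` {..<m}"
  have "inj_on (\<lambda>i. c (e i)) {..<m}"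
  proof (rule inj_onI)
    fix i j assume ij: "i \<in> {..<m}" "j \<in> {..<m}" "c (e i) = c (e j)"
    have "{(i, 0), (i, 1)} = {(j, 0), (j, 1 :: nat)}"
      by (rule inj_onD[OF f(3)]) (use ij in \<open>auto simp: edges_copies_path_2 e_def\<close>)
    then show "i = j" by (auto simp: doubleton_eq_iff)
  qed
  then have card_C0: "card C0 = m" by (simp add: C0_def card_image)
  have "finite C0" by (simp add: C0_def)
  \<comment> \<open>\<open>C\<close> collects the colours outside the matching; \<open>r\<close>
    below picks one edge of each.\<close>
  define C where "C = c ` K - C0"
  have "finite C" using finK by (simp add: C_def)
  have card_C: "card (c ` K) = card C + m"
  proof -
    have "C0 \<subseteq> c ` K" using eK by (auto simp: C0_def)
    then show ?thesis
      using card_Diff_subset[OF \<open>finite C0\<close>] card_mono[of "c ` K" C0] finK card_C0 by (simp add: C_def)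
  qed
  define r where "r = inv_into K c"
  have r: "r x \<in> K" "c (r x) = x" if "x \<in> C" for x
    using that by (auto simp: C_def r_def inv_into_into f_inv_into_f)
  text \<open>The graph whose vertices are the edges of the perfect matching, and whose edges are those
    pairs that are joined by the representative of a colour outside the matching.\<close>
  define \<Gamma> where "\<Gamma> = (\<lambda>x. p ` r x) ` C"
  have \<Gamma>: "q \<subseteq> {..<m} \<and> card q = 2" if "q \<in> \<Gamma>" for q
  proof -
    obtain x where x: "x \<in> C" "q = p ` r x" using \<open>q \<in> \<Gamma>\<close> by (auto simp: \<Gamma>_def)
    obtain a b where ab: "r x = {a, b}" "a \<noteq> b" "a < 2 * m" "b < 2 * m"
      using r(1)[OF x(1)] by (auto simp: K card_2_iff)
    \<comment> \<open>Contraction creates no loop: a representative inside one matching edge would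
      be that edge, and its colour would lie in \<open>C0\<close>.\<close>
    have "p a \<noteq> p b"
    proof
      assume "p a = p b"
      then have "{a, opp a} = {b, opp b}" using opp ab by simp
      then have "r x = e (p a)" using ab opp(2)[of a] by (auto simp: doubleton_eq_iff)
      then have "x \<in> C0" using r(2)[OF x(1)] p_less[of a] ab by (auto simp: C0_def)
      then show False using x by (simp add: C_def)
    qed
    then show ?thesis using x ab p_less by auto
  qed
  \<comment> \<open>Two matching edges are joined by at most four edges, and distinct colours have
    distinct representatives.\<close>
  have fib: "card {x \<in> C. p ` r x = q} \<le> 4" if "q \<in> \<Gamma>" for q
  proof -
    obtain i j where ij: "q = {i, j}" using \<Gamma>[OF \<open>q \<in> \<Gamma>\<close>] by (auto simp: card_2_iff)
    define T where "T = (\<lambda>(v, w). {v, w}) ` (e i \<times> e j)"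
    have e2: "card (e i) \<le> 2" "finite (e i)" for i
      by (auto simp: e_def card_insert_if)
    have "card T \<le> card (e i \<times> e j)" unfolding T_def by (rule card_image_le) (simp add: e2)
    also have "\<dots> \<le> 2 * 2" unfolding card_cartesian_product by (intro mult_mono e2) auto
    finally have "card T \<le> 4" by simp
    have "finite T" by (simp add: T_def e2)
    have "inj_on r {x \<in> C. p ` r x = q}"
      by (rule inj_on_inverseI[of _ c]) (use r(2) in auto)
    moreover have "r ` {x \<in> C. p ` r x = q} \<subseteq> T"
    proof
      fix d assume "d \<in> r ` {x \<in> C. p ` r x = q}"
      then obtain x where x: "x \<in> C" "p ` r x = q" "d = r x" by auto
      obtain a b where ab: "r x = {a, b}" "a \<noteq> b" "a < 2 * m" "b < 2 * m"
        using r(1)[OF x(1)] by (auto simp: K card_2_iff)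
      have "{p a, p b} = {i, j}" using x ab ij by simp
      moreover have "a \<in> e (p a)" "b \<in> e (p b)" using opp(1) ab by blast+
      ultimately have "(a \<in> e i \<and> b \<in> e j) \<or> (b \<in> e i \<and> a \<in> e j)"
        by (auto simp: doubleton_eq_iff)
      then show "d \<in> T" unfolding T_def x(3) ab(1) by (auto simp: image_iff)
    qed
    ultimately have "card {x \<in> C. p ` r x = q} \<le> card T"
      using \<open>finite T\<close> by (rule card_inj_on_le)
    with \<open>card T \<le> 4\<close> show ?thesis by simp
  qed
  have "C = (\<Union>q\<in>\<Gamma>. {x \<in> C. p ` r x = q})" by (auto simp: \<Gamma>_def)
  then have "card C \<le> (\<Sum>q\<in>\<Gamma>. card {x \<in> C. p ` r x = q})"
    using card_UN_le[of \<Gamma> "\<lambda>q. {x \<in> C. p ` r x = q}"] \<open>finite C\<close> by (simp add: \<Gamma>_def)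
  also have "\<dots> \<le> 4 * card \<Gamma>"
    using sum_bounded_above[of \<Gamma> "\<lambda>q. card {x \<in> C. p ` r x = q}" 4] fib by simp
  finally have C4: "card C \<le> 4 * card \<Gamma>" .
  \<comment> \<open>\<open>many\<close>, \<open>card_C\<close> and \<open>C4\<close> give
    \<open>2 * m * m + 8 < 4 * card \<Gamma> + 8 * m\<close>; halving reaches the density that
    yields a matching missing at most two vertices.\<close>
  have "card {..<m} * card {..<m} + 3 < 2 * card \<Gamma> + 4 * card {..<m}"
    using many[folded K_def] card_C C4 by simp
  then obtain M0 where M0: "M0 \<subseteq> \<Gamma>" "pairwise disjnt M0" "m \<le> 2 * card M0 + 2"
    using exists_large_matching[of "{..<m}" \<Gamma>] \<Gamma> by auto
  \<comment> \<open>As \<open>t \<ge> 1\<close>, \<open>2 * k + 1 \<le> 2 * card M0 + 2\<close>, and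
    parity gives the bound.\<close>
  have "k \<le> card M0" using M0(3) m t by simp
  then obtain M where M: "M \<subseteq> M0" "card M = k" "finite M"
    using obtain_subset_with_card_n by metis
  have "M \<subseteq> \<Gamma>" "pairwise disjnt M" using M M0 pairwise_subset by blast+
  \<comment> \<open>One colour is kept per edge of \<open>M\<close>, since several representatives
    may contract to the same pair.\<close>
  obtain D where D: "D \<subseteq> C" "inj_on (\<lambda>x. p ` r x) D" "(\<lambda>x. p ` r x) ` D = M"
    using \<open>M \<subseteq> \<Gamma>\<close> unfolding \<Gamma>_def subset_image_inj by auto
  have "finite D" using D(1) \<open>finite C\<close> finite_subset by blast
  have "card D = k" using D M card_image by fastforce
  then obtain d where d: "bij_betw d {..<k} D"
    using ex_bij_betw_nat_finite[OF \<open>finite D\<close>] by (auto simp: atLeast0LessThan)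
  have "\<exists>a b. r (d i) = {a, b} \<and> a < 2 * m \<and> b < 2 * m" if "i < k" for i
  proof -
    have "d i \<in> C" using d D(1) that by (auto simp: bij_betw_def)
    then show ?thesis using r(1) by (fastforce simp: K card_2_iff)
  qed
  then obtain a b where ab: "\<And>i. i < k \<Longrightarrow> r (d i) = {a i, b i} \<and> a i < 2 * m \<and> b i < 2 * m"
    by metis
  have UM: "\<Union>M = (\<Union>i<k. {p (a i), p (b i)})"
  proof -
    have "M = (\<lambda>x. p ` r x) ` d ` {..<k}" using d D(3) by (simp add: bij_betw_def)
    also have "\<dots> = (\<lambda>i. {p (a i), p (b i)}) ` {..<k}" using ab by (auto simp: image_image)
    finally show ?thesis by simp
  qed
  have "card (\<Union>M) = (\<Sum>q\<in>M. card q)"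
    by (rule card_Union_disjoint[OF \<open>pairwise disjnt M\<close>]) (use \<open>M \<subseteq> \<Gamma>\<close> \<Gamma> finite_subset in blast)
  also have "\<dots> = 2 * k"
    using \<open>M \<subseteq> \<Gamma>\<close> \<Gamma> M by (subst sum.cong[of M M card "\<lambda>_. 2"]) auto
  finally have "card (\<Union>M) = 2 * k" .
  moreover have UM_sub: "\<Union>M \<subseteq> {..<m}" using \<open>M \<subseteq> \<Gamma>\<close> \<Gamma> by blast
  ultimately have "card ({..<m} - \<Union>M) = t"
    using m finite_subset[OF UM_sub] by (simp add: card_Diff_subset)
  \<comment> \<open>The \<open>t\<close> matching edges untouched by \<open>M\<close> will be the
    single-edge components.\<close>
  then obtain q where q: "bij_betw q {..<t} ({..<m} - \<Union>M)"
    using ex_bij_betw_nat_finite[of "{..<m} - \<Union>M"] by (auto simp: atLeast0LessThan)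
  have indices: "{..<m} = (\<Union>i<k. {p (a i), p (b i)}) \<union> q ` {..<t}"
    using q UM UM_sub by (auto simp: bij_betw_def)

  let ?H = "disjoint_union (copies k (path_graph 4)) (copies t (path_graph 2))"
  have vH: "verts ?H = Inl ` ({..<k} \<times> {..<4}) \<union> Inr ` ({..<t} \<times> {..<2})"
    by (simp add: disjoint_union_def verts_copies_path)
  have eH: "edges ?H = (\<lambda>i. {Inl (i, 0), Inl (i, 1)}) ` {..<k} \<union> (\<lambda>i. {Inl (i, 1), Inl (i, 2)}) ` {..<k}
      \<union> (\<lambda>i. {Inl (i, 2), Inl (i, 3)}) ` {..<k} \<union> (\<lambda>i. {Inr (i, 0), Inr (i, 1)}) ` {..<t}"
    by (simp add: disjoint_union_def edges_copies_path_2 edges_copies_path_4 image_Un image_image)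
  have sH: "simple_graph ?H"
    by (intro simple_graph_disjoint_union simple_graph_copies simple_graph_path_graph)
  \<comment> \<open>The chosen representative becomes the middle edge of a path; the matching edges
    at its two ends become the outer edges.\<close>
  define F :: "nat \<times> nat + nat \<times> nat \<Rightarrow> nat" where
    "F = case_sum (\<lambda>(i, j). [opp (a i), a i, b i, opp (b i)] ! j) (\<lambda>(i, j). f (q i, j))"
  have F: "F ` {Inl (i, 0), Inl (i, 1)} = e (p (a i))" "F ` {Inl (i, 1), Inl (i, 2)} = r (d i)"
    "F ` {Inl (i, 2), Inl (i, 3)} = e (p (b i))" if "i < k" for i
  proof -
    have "F (Inl (i, 0)) = opp (a i)" "F (Inl (i, 1)) = a i" "F (Inl (i, 2)) = b i"
      "F (Inl (i, 3)) = opp (b i)"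
      by (simp_all add: F_def)
    then show "F ` {Inl (i, 0), Inl (i, 1)} = e (p (a i))" "F ` {Inl (i, 1), Inl (i, 2)} = r (d i)"
      "F ` {Inl (i, 2), Inl (i, 3)} = e (p (b i))"
      using ab[OF that] opp(1)[of "a i"] opp(2)[of "b i"] by simp_all
  qed
  have F': "F ` {Inr (i, 0), Inr (i, 1)} = e (q i)" for i
    by (simp add: F_def e_def)
  have e_img: "\<exists>d\<in>edges ?H. F ` d = e i" if "i < m" for i
  proof -
    have "i \<in> (\<Union>i<k. {p (a i), p (b i)}) \<union> q ` {..<t}"
      using that unfolding indices[symmetric] by simp
    then consider j where "j < k" "i = p (a j)" | j where "j < k" "i = p (b j)" | j where "j < t" "i = q j"
      by auto
    then show ?thesis
    proof cases
      case (1 j)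
      then show ?thesis
        unfolding eH using F(1)[OF 1(1)] by (intro bexI[of _ "{Inl (j, 0), Inl (j, 1)}"]) auto
    next
      case (2 j)
      then show ?thesis
        unfolding eH using F(3)[OF 2(1)] by (intro bexI[of _ "{Inl (j, 2), Inl (j, 3)}"]) auto
    next
      case (3 j)
      then show ?thesis
        unfolding eH using F' by (intro bexI[of _ "{Inr (j, 0), Inr (j, 1)}"]) auto
    qed
  qed
  have e_sub: "e i \<subseteq> F ` verts ?H" if "i < m" for i
  proof -
    obtain d where "d \<in> edges ?H" "F ` d = e i"
      using e_img[OF \<open>i < m\<close>] by blast
    moreover from this have "d \<subseteq> verts ?H" using sH by (auto simp: simple_graph_def)
    ultimately show ?thesis by blast
  qed
  have card_vH: "card (verts ?H) = 2 * m"
    unfolding vH using m by (subst card_Un_disjoint) (auto simp: card_image)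
  have finH: "finite (verts ?H)" unfolding vH by auto
  \<comment> \<open>Every matching edge lies in the image of \<open>F\<close>, so \<open>F\<close>
    covers all vertices; as \<open>verts ?H\<close> has \<open>2 * m\<close> elements,
    \<open>F\<close> is injective.\<close>
  have "{..<2 * m} \<subseteq> F ` verts ?H"
  proof
    fix v assume "v \<in> {..<2 * m}"
    then have "v \<in> e (p v)" "p v < m" using opp(1)[of v] p_less[of v] by auto
    then show "v \<in> F ` verts ?H" using e_sub by blast
  qed
  then have Fv: "F ` verts ?H = {..<2 * m}"
    by (intro card_seteq[symmetric]) (use finH card_image_le[OF finH, of F] card_vH in auto)
  then have "inj_on F (verts ?H)"
    by (intro eq_card_imp_inj_on finH) (simp add: card_vH)
  \<comment> \<open>Injectivity by counting: the at most \<open>3 * k + t = m + k\<close> edges of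
    \<open>?H\<close> receive all \<open>m + k\<close> colours in
    \<open>C0 \<union> D\<close>.\<close>
  moreover have "inj_on (\<lambda>e. c (F ` e)) (edges ?H)"
  proof -
    have fin: "finite (edges ?H)" unfolding eH by auto
    have img: "card ((\<lambda>i. h i) ` {..<l}) \<le> l" for l :: nat and h :: "nat \<Rightarrow> (nat \<times> nat + nat \<times> nat) set"
      using card_image_le[of "{..<l}" h] by simp
    have "card (edges ?H) \<le> k + k + k + t"
      unfolding eH by (intro order_trans[OF card_Un_le] add_mono img)
    moreover have "C0 \<union> D \<subseteq> (\<lambda>e. c (F ` e)) ` edges ?H"
    proof
      fix x assume "x \<in> C0 \<union> D"
      then consider i where "i < m" "x = c (e i)" | i where "i < k" "x = d i"
        using d by (auto simp: C0_def bij_betw_def)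
      then show "x \<in> (\<lambda>e. c (F ` e)) ` edges ?H"
      proof cases
        case 1
        then obtain d' where "d' \<in> edges ?H" "F ` d' = e i" using e_img by blast
        then show ?thesis using 1 by (intro image_eqI[of _ _ d']) simp_all
      next
        case 2
        then have "x \<in> C" using d D(1) by (auto simp: bij_betw_def)
        then have "c (F ` {Inl (i, 1), Inl (i, 2)}) = x" using F(2)[OF 2(1)] 2 r(2) by simp
        moreover have "{Inl (i, 1), Inl (i, 2)} \<in> edges ?H" unfolding eH using 2 by blast
        ultimately show ?thesis by (intro image_eqI[of _ _ "{Inl (i, 1), Inl (i, 2)}"]) simp_all
      qed
    qed
    then have "card (C0 \<union> D) \<le> card ((\<lambda>e. c (F ` e)) ` edges ?H)"
      using fin by (intro card_mono) auto
    moreover have "card (C0 \<union> D) = m + k"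
      using card_Un_disjoint[OF \<open>finite C0\<close> \<open>finite D\<close>] D(1) card_C0 \<open>card D = k\<close>
      by (auto simp: C_def)
    moreover have "card ((\<lambda>e. c (F ` e)) ` edges ?H) \<le> card (edges ?H)"
      using fin by (rule card_image_le)
    ultimately show ?thesis
      using m by (intro eq_card_imp_inj_on fin) linarith
  qed
  ultimately show ?thesis
    unfolding has_rainbow_copy_complete_iff[OF sH] using Fv by blast
qed

section \<open>Equality of the two anti-Ramsey numbers\<close>

theorem theorem2:
  fixes k t n :: nat
  assumes "k \<ge> 1" and "t \<ge> 1" and "n = 4 * k + 2 * t"
  shows "AR n (disjoint_union (copies k (path_graph 4)) (copies t (path_graph 2)))
       = AR n (copies (2 * k + t) (path_graph 2))"
proof -
  let ?H = "disjoint_union (copies k (path_graph 4)) (copies t (path_graph 2))"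
  define m where "m = 2 * k + t"
  have n: "n = 2 * m" and "m \<ge> 3" using assms by (simp_all add: m_def)
  obtain c0 :: "nat set \<Rightarrow> nat"
    where c0: "\<not> has_rainbow_copy c0 (complete_graph n) (copies m (path_graph 2))"
      and card_c0: "2 * m * m + 8 \<le> card (c0 ` edges (complete_graph n)) + 7 * m"
    using exists_colouring_without_rainbow_perfect_matching[OF \<open>m \<ge> 3\<close>] unfolding n by blast
  \<comment> \<open>This also makes the set nonempty, so that its \<open>Max\<close> is
    meaningful.\<close>
  have c0_in: "card (c0 ` edges (complete_graph n)) \<in> rainbow_free_counts n (copies m (path_graph 2))"
    using c0 by (auto simp: rainbow_free_counts_def)
  \<comment> \<open>A rainbow linear forest contains a rainbow matching, so avoiding the matching is
    the stronger condition.\<close>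
  have sub: "rainbow_free_counts n (copies m (path_graph 2)) \<subseteq> rainbow_free_counts n ?H"
    using rainbow_matching_of_rainbow_linear_forest[of _ n k t]
    unfolding rainbow_free_counts_def m_def by blast
  have "AR n (copies m (path_graph 2)) \<le> AR n ?H"
    unfolding AR_def by (rule Max_mono[OF sub]) (use c0_in finite_rainbow_free_counts in auto)
  moreover have "AR n ?H \<le> AR n (copies m (path_graph 2))"
    unfolding AR_def
  proof (rule Max.boundedI)
    fix x assume "x \<in> rainbow_free_counts n ?H"
    then obtain c :: "nat set \<Rightarrow> nat" where x: "x = card (c ` edges (complete_graph n))"
      and c: "\<not> has_rainbow_copy c (complete_graph n) ?H"
      by (auto simp: rainbow_free_counts_def)
    \<comment> \<open>If \<open>c\<close> has a rainbow perfect matching, it uses at most as many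
      colours as \<open>c0\<close>; otherwise \<open>c\<close> itself is admissible for the
      matching.\<close>
    have "\<exists>y\<in>rainbow_free_counts n (copies m (path_graph 2)). x \<le> y"
    proof (cases "has_rainbow_copy c (complete_graph n) (copies m (path_graph 2))")
      case True
      then have "x + 7 * m \<le> 2 * m * m + 8"
        using c rainbow_linear_forest_of_rainbow_perfect_matching[OF \<open>t \<ge> 1\<close> m_def, of c]
        unfolding n x by force
      then show ?thesis using card_c0 c0_in by (intro bexI[OF _ c0_in]) simp
    next
      case False
      then show ?thesis using x by (auto simp: rainbow_free_counts_def)
    qed
    then show "x \<le> Max (rainbow_free_counts n (copies m (path_graph 2)))"
      using finite_rainbow_free_counts Max_ge order_trans by meson
  qed (use finite_rainbow_free_counts sub c0_in in auto)
  ultimately show ?thesis unfolding m_def by simp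
qed

end
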